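(* Let $B_n$ denote the Bernoulli numbers, defined by $\sum_{n\ge0}B_n\frac{x^n}{n!}=\frac{x}{e^x-1}$, and set $\tilde B_n=(n+1)B_n$. Then for every nonnegative integer $n$, \begin{align*} \frac1{n+1}\sum_{i=0}^{n+1}2^{n+1-i}\binom{n+1}i\tilde B_{n+i}&=(-1)^n,\\ \frac1{n+1}\sum_{i=0}^{n+1}3^{n+1-i}\binom{n+1}i\tilde B_{n+i}&=(-2)^{n-1}(n-4),\\ \frac1{n+1}\sum_{i=0}^{n+1}4^{n+1-i}\binom{n+1}i\tilde B_{n+i}&=(-1)^n\bigl(4^n+(2-\tfrac43 n)3^n\bigr), \end{align*} and in general, for every positive integer $k$, \[\frac1{n+1}\sum_{i=0}^{n+1}k^{n+1-i}\binom{n+1}i\tilde B_{n+i}=\sum_{i=1}^{k-1}\bigl((2n+1)i-(n+1)k\bigr)\,i^n(i-k)^{n-1}.\]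
   Context: Powers with negative exponent (e.g. $(i-k)^{-1}$ when $n=0$) are interpreted as rational numbers. *)

theory Defs
  imports Complex_Main "HOL-Computational_Algebra.Formal_Power_Series"
begin

text \<open>
  The exponential generating function is read as an identity of formal power series over the
  rationals; the denominator has subdegree 1, so the quotient is the exact one (see
  \<open>bernoulli_egf\<close>). In particular the value at 1 is \<open>-1/2\<close>.
\<close>

definition bernoulli :: "nat \<Rightarrow> rat" where
  "bernoulli n = fact n * fps_nth (fps_X / (fps_exp 1 - 1)) n"

definition bernoulli_tilde :: "nat \<Rightarrow> rat" where
  "bernoulli_tilde n = (of_nat n + 1) * bernoulli n"

lemma bernoulli_egf:
  "Abs_fps (\<lambda>n. bernoulli n / fact n) * (fps_exp 1 - 1) = (fps_X :: rat fps)"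
proof -
  let ?E = "fps_exp 1 - 1 :: rat fps"
  have nth1: "fps_nth ?E 1 = 1" by simp
  have nz: "?E \<noteq> 0"
    using nth1 by (metis fps_zero_nth zero_neq_one)
  have "subdegree ?E \<le> 1"
    using nth1 by (intro subdegree_leI) simp
  hence "?E dvd fps_X"
    using nz by (simp add: fps_dvd_iff)
  hence "fps_X / ?E * ?E = fps_X"
    by (rule dvd_div_mult_self)
  moreover have "Abs_fps (\<lambda>n. bernoulli n / fact n) = fps_X / ?E"
    by (simp add: fps_eq_iff bernoulli_def)
  ultimately show ?thesis by simp
qed

end

theory Submission
  imports Defs "HOL-Computational_Algebra.Polynomial"
begin

text \<open>
  Let \<open>L\<close> be the umbral functional on rational polynomials with \<open>L (x^n) = B_n\<close>. The generating
  function gives the two rules \<open>L (f (x + 1)) = L f + f' 0\<close> and \<open>L (f (- x)) = L f + f' 0\<close>.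
  The sum on the left is \<open>L (g')\<close> for \<open>g = (x (x + k))^(n + 1)\<close>. As \<open>g'\<close> is odd under
  \<open>x \<mapsto> - x - k\<close>, applying both rules to \<open>h x = g' (x - k)\<close> gives
  \<open>2 L (g') = (\<Sum>i=1..k-1. h' i)\<close>, which is \<open>2 (n + 1)\<close> times the
  right-hand side after symmetrizing the latter under \<open>i \<mapsto> k - i\<close>.
\<close>

section \<open>Bernoulli number identities from the generating function\<close>

text \<open>Compare coefficients in F * exp(X) = F + X, where F is the generating function; the
  summand X is the exception at \<open>n = 1\<close>.\<close>

lemma bernoulli_binomial_sum:
  "(\<Sum>i\<le>n. of_nat (n choose i) * bernoulli i) = bernoulli n + (if n = 1 then 1 else 0)"
proof -
  let ?F = "Abs_fps (\<lambda>n. bernoulli n / fact n)"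
  have "?F * fps_exp 1 = ?F + fps_X"
    using bernoulli_egf by (simp add: algebra_simps)
  hence "fps_nth (?F * fps_exp 1) n = bernoulli n / fact n + (if n = 1 then 1 else 0)"
    by simp
  hence "(\<Sum>i\<le>n. bernoulli i / fact i * (1 / fact (n - i)))
      = bernoulli n / fact n + (if n = 1 then 1 else 0)"
    by (simp add: fps_mult_nth atLeast0AtMost)
  hence "fact n * (\<Sum>i\<le>n. bernoulli i / fact i * (1 / fact (n - i)))
      = bernoulli n + (if n = 1 then 1 else 0)"
    by (simp add: distrib_left)
  thus ?thesis
    by (simp add: sum_distrib_left binomial_fact mult_ac)
qed

text \<open>Coefficient form of F(-X) = F(X) + X: after multiplication by exp(X) - 1, which can be
  cancelled, both sides become X * exp(X).\<close>

lemma bernoulli_reflect: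
  "(-1) ^ n * bernoulli n = bernoulli n + (if n = 1 then 1 else 0)"
proof -
  let ?F = "Abs_fps (\<lambda>n. bernoulli n / fact n)"
  let ?G = "?F oo (fps_const (-1) * fps_X)"
  let ?E = "fps_exp (1::rat)"
  have "(?F * (?E - 1)) oo (fps_const (-1) * fps_X) = - fps_X"
    by (subst bernoulli_egf) (simp add: fps_eq_iff)
  hence "?G * (fps_exp (-1) - 1) = - fps_X"
    by (subst (asm) fps_compose_mult_distrib)
      (simp_all add: fps_compose_sub_distrib fps_exp_compose_linear)
  hence "?G * (fps_exp (-1) - 1) * ?E = - fps_X * ?E"
    by simp
  moreover have "(fps_exp (-1) - 1) * ?E = 1 - ?E"
    by (simp add: algebra_simps flip: fps_exp_add_mult)
  ultimately have "?G * (1 - ?E) = - fps_X * ?E"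
    by (simp only: mult.assoc)
  hence "?G * (?E - 1) = fps_X * ?E"
    by (simp add: algebra_simps)
  also have "\<dots> = (?F + fps_X) * (?E - 1)"
    using bernoulli_egf by (simp add: algebra_simps)
  finally have "?G = ?F + fps_X"
  proof (rule mult_right_cancel[THEN iffD1, rotated])
    have "fps_nth (?E - 1) 1 \<noteq> 0" by simp
    thus "?E - 1 \<noteq> 0" by (metis fps_zero_nth)
  qed
  hence "fps_nth ?G n = bernoulli n / fact n + (if n = 1 then 1 else 0)"
    by simp
  hence "(-1) ^ n * (bernoulli n / fact n) = bernoulli n / fact n + (if n = 1 then 1 else 0)"
    by (simp add: fps_compose_linear)
  thus ?thesis
    by (simp add: field_simps split: if_splits)
qed

section \<open>The umbral functional and its transformation rules\<close>

definition umbral :: "rat poly \<Rightarrow> rat" where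
  "umbral p = (\<Sum>i\<le>degree p. coeff p i * bernoulli i)"

text \<open>Lets polynomials of different degrees share one summation bound, as additivity
  requires.\<close>

lemma umbral_eq_sum:
  assumes "degree p \<le> N"
  shows "umbral p = (\<Sum>i\<le>N. coeff p i * bernoulli i)"
  unfolding umbral_def
  by (rule sum.mono_neutral_left) (use assms in \<open>auto simp: coeff_eq_0\<close>)

lemma umbral_add: "umbral (p + q) = umbral p + umbral q"
proof -
  define N where "N = max (degree p) (degree q)"
  have "degree (p + q) \<le> N" "degree p \<le> N" "degree q \<le> N"
    by (auto simp: N_def degree_add_le_max)
  thus ?thesis
    by (simp add: umbral_eq_sum[of _ N] distrib_right sum.distrib)
qed

lemma umbral_smult: "umbral (smult c p) = c * umbral p"
  by (simp add: umbral_eq_sum[of "smult c p" "degree p"] umbral_def sum_distrib_left mult_ac)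

lemma umbral_uminus: "umbral (- p) = - umbral p"
  using umbral_smult[of "-1" p] by simp

lemma umbral_monom: "umbral (monom c n) = c * bernoulli n"
  by (simp add: umbral_eq_sum[of "monom c n" n] degree_monom_le if_distrib[of "\<lambda>x. x * _"]
      cong: if_cong)

lemma umbral_sum: "umbral (\<Sum>i\<in>A. f i) = (\<Sum>i\<in>A. umbral (f i))"
  by (induction A rule: infinite_finite_induct)
    (simp_all add: umbral_add umbral_smult[of 0 0, simplified])

text \<open>Monomials span the polynomials, so each umbral rule reduces to an identity between
  Bernoulli numbers.\<close>

lemma linear_poly_functional_eqI:
  fixes F G :: "'a::comm_ring_1 poly \<Rightarrow> 'a"
  assumes F: "\<And>p q. F (p + q) = F p + F q" "\<And>c p. F (smult c p) = c * F p"
    and G: "\<And>p q. G (p + q) = G p + G q" "\<And>c p. G (smult c p) = c * G p"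
    and eq: "\<And>n. F (monom 1 n) = G (monom 1 n)"
  shows "F p = G p"
proof -
  have monom: "F (monom c n) = G (monom c n)" for c n
    using F(2)[of c "monom 1 n"] G(2)[of c "monom 1 n"] eq[of n] by (simp add: smult_monom)
  have zero: "F 0 = 0" "G 0 = 0"
    using F(2)[of 0 0] G(2)[of 0 0] by simp_all
  have "F (\<Sum>i\<in>A. monom (f i) i) = G (\<Sum>i\<in>A. monom (f i) i)" if "finite A" for A f
    using that by (induction A rule: finite_induct) (simp_all add: F(1) G(1) monom zero)
  from this[of "{..degree p}" "coeff p"] show ?thesis
    by (simp add: poly_as_sum_of_monoms)
qed

lemma poly_pderiv_monom_0:
  "poly (pderiv (monom 1 n)) 0 = (if n = 1 then 1 else (0::rat))"
  by (cases n) (auto simp: pderiv_monom poly_monom power_0_left)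

text \<open>On monomials this is \<open>bernoulli_binomial_sum\<close>: the derivative of x^n at 0
  is 1 for n = 1 and 0 otherwise.\<close>

lemma umbral_shift: "umbral (pcompose p [:1, 1:]) = umbral p + poly (pderiv p) 0"
proof (rule linear_poly_functional_eqI[where p = p])
  fix n
  have "umbral (pcompose (monom 1 n) [:1, 1:]) = (\<Sum>i\<le>n. of_nat (n choose i) * bernoulli i)"
  proof -
    have "pcompose (monom (1::rat) n) [:1, 1:] = (\<Sum>i\<le>n. monom (of_nat (n choose i)) i)"
      by (rule poly_ext) (simp add: poly_pcompose poly_monom poly_sum add.commute[of 1]
          binomial_ring)
    thus ?thesis
      by (simp add: umbral_sum umbral_monom)
  qed
  thus "umbral (pcompose (monom 1 n) [:1, 1:])
      = umbral (monom 1 n) + poly (pderiv (monom 1 n)) 0"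
    by (simp only: bernoulli_binomial_sum umbral_monom poly_pderiv_monom_0 mult_1)
qed (simp_all add: pcompose_add pcompose_smult umbral_add umbral_smult pderiv_add
    pderiv_smult algebra_simps)

lemma umbral_reflect: "umbral (pcompose p [:0, -1:]) = umbral p + poly (pderiv p) 0"
proof (rule linear_poly_functional_eqI[where p = p])
  fix n
  have "pcompose (monom (1::rat) n) [:0, -1:] = monom ((-1) ^ n) n"
    by (rule poly_ext) (simp add: poly_pcompose poly_monom flip: power_mult_distrib)
  thus "umbral (pcompose (monom 1 n) [:0, -1:])
      = umbral (monom 1 n) + poly (pderiv (monom 1 n)) 0"
    by (simp only: bernoulli_reflect umbral_monom poly_pderiv_monom_0 mult_1)
qed (simp_all add: pcompose_add pcompose_smult umbral_add umbral_smult pderiv_add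
    pderiv_smult algebra_simps)

text \<open>Iterate the unit shift: the step from \<open>k\<close> to \<open>Suc k\<close> adds the
  derivative at 0 of the polynomial already shifted by \<open>k\<close>.\<close>

lemma umbral_shift_of_nat:
  "umbral (pcompose p [:of_nat k, 1:]) = umbral p + (\<Sum>i<k. poly (pderiv p) (of_nat i))"
proof (induction k)
  case 0
  show ?case by (simp add: pcompose_idR)
next
  case (Suc k)
  let ?q = "pcompose p [:of_nat k, 1:]"
  have "pcompose p [:of_nat (Suc k), 1:] = pcompose ?q [:1, 1:]"
    by (rule poly_ext) (simp add: poly_pcompose algebra_simps)
  moreover have "poly (pderiv ?q) 0 = poly (pderiv p) (of_nat k)"
    by (simp add: pderiv_pcompose poly_pcompose pderiv_pCons)
  ultimately show ?case
    using Suc by (simp add: umbral_shift)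
qed

text \<open>Moving \<open>p\<close> to \<open>h\<close> makes a shift by \<open>k\<close> return
  \<open>p\<close> and, by oddness about -k/2, a reflection return \<open>- p\<close>. Subtracting
  the two rules eliminates \<open>umbral h\<close> and the term at \<open>i = 0\<close>.\<close>

lemma umbral_odd:
  assumes odd: "\<And>x. poly p (- x - of_nat k) = - poly p x" and "k > 0"
  shows "2 * umbral p = (\<Sum>i=1..k-1. poly (pderiv p) (of_nat i - of_nat k))"
proof -
  define h where "h = pcompose p [:- of_nat k, 1:]"
  have "pcompose h [:of_nat k, 1:] = p"
    by (rule poly_ext) (simp add: h_def poly_pcompose)
  hence 1: "umbral p = umbral h + (\<Sum>i<k. poly (pderiv h) (of_nat i))"
    using umbral_shift_of_nat[of h k] by simp
  have "pcompose h [:0, -1:] = - p"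
    by (rule poly_ext) (use odd in \<open>simp add: h_def poly_pcompose algebra_simps\<close>)
  hence 2: "- umbral p = umbral h + poly (pderiv h) 0"
    using umbral_reflect[of h] by (simp add: umbral_uminus)
  have "{..<k} = insert 0 {1..k-1}"
    using \<open>k > 0\<close> by auto
  hence "(\<Sum>i<k. poly (pderiv h) (of_nat i))
      = poly (pderiv h) 0 + (\<Sum>i=1..k-1. poly (pderiv h) (of_nat i))"
    by simp
  moreover have "poly (pderiv h) x = poly (pderiv p) (x - of_nat k)" for x
    by (simp add: h_def pderiv_pcompose poly_pcompose pderiv_pCons)
  ultimately show ?thesis
    using 1 2 by simp
qed

section \<open>Evaluation of both sides\<close>

lemma umbral_pderiv_monom: "umbral (pderiv (monom c (Suc n))) = c * bernoulli_tilde n"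
  by (simp add: pderiv_monom umbral_monom bernoulli_tilde_def)

text \<open>Expand x^(n+1) * (x+k)^(n+1) binomially. Differentiating x^(n+i+1) yields the factor
  n+i+1 that turns B_(n+i) into its tilde version.\<close>

lemma umbral_pderiv_power:
  "umbral (pderiv ([:0, of_nat k, 1:] ^ (n + 1)))
    = (\<Sum>i=0..n+1. of_nat k ^ (n+1-i) * of_nat ((n+1) choose i) * bernoulli_tilde (n+i))"
proof -
  have "[:0, of_nat k, 1:] ^ (n + 1)
      = (\<Sum>i=0..n+1. monom (of_nat k ^ (n+1-i) * of_nat ((n+1) choose i)) (Suc (n+i)) :: rat poly)"
    (is "?l = ?r")
  proof (rule poly_ext)
    fix x :: rat
    have "poly ?l x = x ^ (n + 1) * (x + of_nat k) ^ (n + 1)"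
      by (simp add: algebra_simps flip: power_mult_distrib power_Suc)
    also have "\<dots> = poly ?r x"
      unfolding binomial_ring poly_sum poly_monom sum_distrib_left atLeast0AtMost
      by (intro sum.cong) (simp_all add: power_add mult_ac)
    finally show "poly ?l x = poly ?r x" .
  qed
  thus ?thesis
    \<comment> \<open>The instance \<open>n = 1\<close> says that \<open>pderiv\<close> commutes
      with finite sums.\<close>
    by (simp only: higher_pderiv_sum[where n = 1, simplified] umbral_sum umbral_pderiv_monom)
qed

lemma sum_reflect:
  fixes f :: "nat \<Rightarrow> 'a::comm_monoid_add"
  shows "(\<Sum>i=1..k-1. f i) = (\<Sum>i=1..k-1. f (k - i))"
  by (rule sum.reindex_bij_witness[of _ "\<lambda>i. k - i" "\<lambda>i. k - i"]) auto

lemma bernoulli_tilde_sum: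
  assumes "k > 0"
  shows "1 / (of_nat n + 1) *
      (\<Sum>i=0..n+1. of_nat k ^ (n+1-i) * of_nat ((n+1) choose i) * bernoulli_tilde (n+i))
    = (\<Sum>i=1..k-1. ((2 * of_nat n + 1) * of_nat i - (of_nat n + 1) * of_nat k)
         * of_nat i ^ n * (of_nat i - of_nat k) powi (int n - 1))"
    (is "1 / _ * ?S = (\<Sum>i=1..k-1. ?T i)")
proof -
  define q :: "rat poly" where "q = [:0, of_nat k, 1:]"
  define p where "p = pderiv (q ^ (n + 1))"
  have p: "p = smult (of_nat n + 1) (q ^ n * [:of_nat k, 2:])"
    by (rule poly_ext)
      (simp add: p_def q_def pderiv_power_Suc pderiv_pCons algebra_simps del: power_Suc)
  \<comment> \<open>The reflection about -k/2 fixes \<open>q\<close> and negates its derivative 2x +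
    k.\<close>
  have "poly p (- x - of_nat k) = - poly p x" for x
  proof -
    have "poly q (- x - of_nat k) = poly q x"
      by (simp add: q_def algebra_simps)
    thus ?thesis by (simp add: p algebra_simps)
  qed
  hence "2 * ?S = (\<Sum>i=1..k-1. poly (pderiv p) (of_nat i - of_nat k))"
    using umbral_odd[of p k] assms umbral_pderiv_power[of k n] by (simp only: p_def q_def)
  \<comment> \<open>Single summands need not match: the derivative is symmetric under exchanging
    \<open>i\<close> and \<open>k - i\<close>, while \<open>?T\<close> in general is not.\<close>
  also have "\<dots> = (\<Sum>i=1..k-1. (of_nat n + 1) * (?T i + ?T (k - i)))"
  proof (rule sum.cong[OF refl])
    fix i assume i: "i \<in> {1..k-1}"
    define a b :: rat where "a = of_nat i" and "b = of_nat (k - i)"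
    have a: "of_nat i = a" and b: "of_nat (k - i) = b" and k: "of_nat k = a + b"
      using i by (auto simp: a_def b_def simp flip: of_nat_add)
    have nz: "a \<noteq> 0" "b \<noteq> 0"
      using i by (auto simp: a_def b_def)
    have pow: "(of_nat i - of_nat k :: rat) = - b" "(of_nat (k - i) - of_nat k :: rat) = - a"
      unfolding k a b by simp_all
    show "poly (pderiv p) (of_nat i - of_nat k) = (of_nat n + 1) * (?T i + ?T (k - i))"
    \<comment> \<open>For \<open>n = 0\<close> the exponent is -1, so \<open>nz\<close> is needed to
      cancel the reciprocals; otherwise \<open>powi\<close> is an ordinary power.\<close>
    proof (cases n)
      case 0
      show ?thesis
        unfolding pow a b k using nz
        by (simp add: 0 p pderiv_pCons field_simps)
    next
      case (Suc m)
      have q: "poly q (- b) = - (a * b)"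
        unfolding q_def k by (simp add: algebra_simps)
      have q': "poly (pderiv q) (- b) = a - b"
        unfolding q_def k by (simp add: pderiv_pCons)
      have "poly (pderiv p) (- b) = (of_nat n + 1) *
          ((of_nat m + 1) * (- (a * b)) ^ m * (a - b) * (a - b) + 2 * (- (a * b)) ^ n)"
      proof -
        have "pderiv [:of_nat k, 2:] = [:2 :: rat:]"
          by (simp add: pderiv_pCons)
        hence "pderiv p = smult (of_nat n + 1)
            (q ^ n * [:2:] + [:of_nat k, 2:] * (smult (of_nat (Suc m)) (q ^ m) * pderiv q))"
          unfolding p Suc by (simp only: pderiv_smult pderiv_mult pderiv_power_Suc)
        thus ?thesis
          by (simp only: poly_smult poly_add poly_mult poly_power poly_pCons poly_0 q q' k)
            (simp add: algebra_simps)
      qed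
      also have "\<dots> = (of_nat n + 1) * (?T i + ?T (k - i))"
        unfolding pow a b k
        by (simp add: Suc power_minus[of "a * b"] power_minus[of a] power_minus[of b]
            power_mult_distrib algebra_simps)
      finally show ?thesis unfolding pow .
    qed
  qed
  also have "\<dots> = (of_nat n + 1) * (2 * (\<Sum>i=1..k-1. ?T i))"
    using sum_reflect[of ?T k] by (simp add: sum.distrib flip: sum_distrib_left)
  finally have "?S = (of_nat n + 1) * (\<Sum>i=1..k-1. ?T i)"
    by simp
  moreover have "of_nat n + 1 \<noteq> (0::rat)"
    by (metis of_nat_Suc of_nat_neq_0 add.commute)
  ultimately show ?thesis by simp
qed

theorem theorem7p3:
  fixes n :: nat
  shows
    "1 / (of_nat n + 1) *
        (\<Sum>i=0..n+1. 2 ^ (n+1-i) * of_nat ((n+1) choose i) * bernoulli_tilde (n+i))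
       = (-1) ^ n
     \<and> 1 / (of_nat n + 1) *
        (\<Sum>i=0..n+1. 3 ^ (n+1-i) * of_nat ((n+1) choose i) * bernoulli_tilde (n+i))
       = (-2) powi (int n - 1) * (of_nat n - 4)
     \<and> 1 / (of_nat n + 1) *
        (\<Sum>i=0..n+1. 4 ^ (n+1-i) * of_nat ((n+1) choose i) * bernoulli_tilde (n+i))
       = (-1) ^ n * (4 ^ n + (2 - 4/3 * of_nat n) * 3 ^ n)
     \<and> (\<forall>k::nat. k > 0 \<longrightarrow>
        1 / (of_nat n + 1) *
          (\<Sum>i=0..n+1. of_nat k ^ (n+1-i) * of_nat ((n+1) choose i) * bernoulli_tilde (n+i))
        = (\<Sum>i=1..k-1. ((2 * of_nat n + 1) * of_nat i - (of_nat n + 1) * of_nat k)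
             * of_nat i ^ n * (of_nat i - of_nat k) powi (int n - 1)))"
proof (intro conjI allI impI)
  have interval: "{1..2 - 1} = {1::nat}" "{1..3 - 1} = {1, 2::nat}" "{1..4 - 1} = {1, 2, 3::nat}"
    by auto
  \<comment> \<open>The only term has coefficient (2n+1) - 2(n+1) = -1.\<close>
  have "(\<Sum>i=1..2-1. ((2 * of_nat n + 1) * of_nat i - (of_nat n + 1) * of_nat 2)
      * of_nat i ^ n * (of_nat i - of_nat 2) powi (int n - 1)) = (-1 :: rat) ^ n"
    unfolding interval by (cases n) (simp_all add: algebra_simps)
  with bernoulli_tilde_sum[of 2 n] show "1 / (of_nat n + 1) *
      (\<Sum>i=0..n+1. 2 ^ (n+1-i) * of_nat ((n+1) choose i) * bernoulli_tilde (n+i)) = (-1) ^ n"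
    by simp
  \<comment> \<open>The terms are -(n+2) and 2(n-1) times (-2)^(n-1).\<close>
  have "(\<Sum>i=1..3-1. ((2 * of_nat n + 1) * of_nat i - (of_nat n + 1) * of_nat 3)
      * of_nat i ^ n * (of_nat i - of_nat 3) powi (int n - 1))
    = (-2 :: rat) powi (int n - 1) * (of_nat n - 4)"
    unfolding interval
    by (cases n) (simp_all add: algebra_simps power_minus[of 2])
  with bernoulli_tilde_sum[of 3 n] show "1 / (of_nat n + 1) *
      (\<Sum>i=0..n+1. 3 ^ (n+1-i) * of_nat ((n+1) choose i) * bernoulli_tilde (n+i))
    = (-2) powi (int n - 1) * (of_nat n - 4)"
    by simp
  \<comment> \<open>The middle term is (-4)^n; the outer two combine to (2 - 4n/3) * (-3)^n.\<close>
  have "(\<Sum>i=1..4-1. ((2 * of_nat n + 1) * of_nat i - (of_nat n + 1) * of_nat 4)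
      * of_nat i ^ n * (of_nat i - of_nat 4) powi (int n - 1))
    = (-1 :: rat) ^ n * (4 ^ n + (2 - 4/3 * of_nat n) * 3 ^ n)"
  proof (cases n)
    case (Suc m)
    have "(4::rat) ^ m = 2 ^ m * 2 ^ m"
      by (simp flip: power_mult_distrib)
    thus ?thesis
      unfolding interval
      by (simp add: Suc field_simps power_minus[of 2] power_minus[of 3])
  qed (simp add: interval)
  with bernoulli_tilde_sum[of 4 n] show "1 / (of_nat n + 1) *
      (\<Sum>i=0..n+1. 4 ^ (n+1-i) * of_nat ((n+1) choose i) * bernoulli_tilde (n+i))
    = (-1) ^ n * (4 ^ n + (2 - 4/3 * of_nat n) * 3 ^ n)"
    by simp
qed (rule bernoulli_tilde_sum)

end
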